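(* Let $\mathcal A$ be a PTA and $v$ a parameter valuation. Assume the algorithm $\mathrm{TPS}(\mathcal A,v)$ terminates with constraint $K$. Then $v\models K$, and for every parameter valuation $v'\models K$, $\mathrm{Traces}(v'(\mathcal A))=\mathrm{Traces}(v(\mathcal A))$.
   Context: PTA: clocks $X$ (real-valued), parameters $P$ (nonnegative rationals), atomic constraints $x\sim p+c$, $x\sim c$, $p\sim c$; a PTA $(\Sigma,L,\ell_0,X,P,I,E)$ has invariants $I(\ell)$ and edges $(\ell,g,a,R,\ell')$. $v(\mathcal A)$ is the timed automaton obtained by substituting parameter values; runs are maximal step sequences $s_0\xrightarrow{d_0,e_0}s_1\cdots$ from $(\ell_0,\mathbf 0)$ with steps for delay $d\ge0$ when $w+d$ satisfies the guard and $w'=(w+d)[R\mapsto0]$; the untimed trace of a run is $(\ell_i,a_i)_i$ and $\mathrm{Traces}(v(\mathcal A))$ the set of traces. Symbolic semantics: a symbolic state is $(\ell,C)$ with $C$ a conjunction of constraints over $X\cup P$ possibly including diagonal constraints $x-x'\sim p+c$, $x-x'\sim c$. $C\!\uparrow$ (time elapsing) is satisfied by $(w+d,v)$ whenever $(w,v)\models C$, $d\ge0$; $C[R]$ (reset) by valuations obtained from one satisfying $C$ by setting clocks in $R$ to $0$; $C{\downarrow}_P$ is the projection onto $P$ (existential elimination of clocks). Initial symbolic state $s_0=(\ell_0,(X=0)\!\uparrow\wedge I(\ell_0))$. For edge $e=(\ell,g,a,R,\ell')$, $\mathrm{Succ}_e((\ell,C))=\{(\ell',C')\}$ with $C'=((C\wedge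 g)[R])\!\uparrow\wedge I(\ell')$ if $C'$ is satisfiable, else empty; $\mathrm{Succ}(S)$ is the union over states in $S$ and edges. $(\ell,C)$ is $v$-compatible if $v\models C{\downarrow}_P$. Algorithm $\mathrm{TPS}(\mathcal A,v)$: set $K_{good}:=\mathrm{true}$, $K_{bad}:=\mathrm{false}$, $S_{new}:=\{s_0\}$, $S:=\emptyset$. Repeat: for each $(\ell,C)\in S_{new}$: if $v\models C{\downarrow}_P$ then $K_{good}:=K_{good}\wedge C{\downarrow}_P$, else $K_{bad}:=K_{bad}\vee C{\downarrow}_P$ and remove $(\ell,C)$ from $S_{new}$. Then, if $S_{new}\subseteq S$, return $K_{good}\wedge\neg K_{bad}$; otherwise $S:=S\cup S_{new}$, $S_{new}:=\mathrm{Succ}(S_{new})$.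
   Formalization: Traces are taken over all finite or infinite runs, not only maximal ones (with maximal runs the claim fails: deadlocks may differ within K); invariants, unspecified for concrete steps, must hold when a location is left, and on entry only now or after some delay. *)

theory Defs
  imports Complex_Main "HOL-Library.FuncSet" "HOL-Library.Extended_Nat"
begin

section \<open>Parametric timed automata\<close>

datatype cmp = Lt | Le | Eq | Ge | Gt

fun compare :: "cmp \<Rightarrow> real \<Rightarrow> real \<Rightarrow> bool" where
  "compare Lt s t \<longleftrightarrow> s < t"
| "compare Le s t \<longleftrightarrow> s \<le> t"
| "compare Eq s t \<longleftrightarrow> s = t"
| "compare Ge s t \<longleftrightarrow> s \<ge> t"
| "compare Gt s t \<longleftrightarrow> s > t"

text \<open>Atomic constraints \<open>x \<sim> p + c\<close>, \<open>x \<sim> c\<close> and \<open>p \<sim> c\<close>, with rational constants.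
  A list of atoms stands for their conjunction.\<close>

datatype ('x, 'p) atom =
    ClockParam 'x cmp 'p rat
  | ClockConst 'x cmp rat
  | ParamConst 'p cmp rat

type_synonym ('x, 'p) constr = "('x, 'p) atom list"

type_synonym ('a, 'l, 'x, 'p) edge = "'l \<times> ('x, 'p) constr \<times> 'a \<times> 'x set \<times> 'l"

record ('a, 'l, 'x, 'p) pta =
  acts :: "'a set"
  locs :: "'l set"
  loc0 :: 'l
  clocks :: "'x set"
  params :: "'p set"
  invar :: "'l \<Rightarrow> ('x, 'p) constr"
  edges :: "('a, 'l, 'x, 'p) edge set"

fun atom_over :: "'x set \<Rightarrow> 'p set \<Rightarrow> ('x, 'p) atom \<Rightarrow> bool" where
  "atom_over X P (ClockParam x r p c) \<longleftrightarrow> x \<in> X \<and> p \<in> P"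
| "atom_over X P (ClockConst x r c) \<longleftrightarrow> x \<in> X"
| "atom_over X P (ParamConst p r c) \<longleftrightarrow> p \<in> P"

definition constr_over :: "'x set \<Rightarrow> 'p set \<Rightarrow> ('x, 'p) constr \<Rightarrow> bool" where
  "constr_over X P C \<longleftrightarrow> (\<forall>t \<in> set C. atom_over X P t)"

definition is_pta :: "('a, 'l, 'x, 'p) pta \<Rightarrow> bool" where
  "is_pta A \<longleftrightarrow>
     finite (acts A) \<and> finite (locs A) \<and> finite (clocks A) \<and> finite (params A) \<and> finite (edges A) \<and>
     loc0 A \<in> locs A \<and>
     (\<forall>l \<in> locs A. constr_over (clocks A) (params A) (invar A l)) \<and>
     (\<forall>(l, g, a, R, l') \<in> edges A.
        l \<in> locs A \<and> constr_over (clocks A) (params A) g \<and> a \<in> acts A \<and>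
        R \<subseteq> clocks A \<and> l' \<in> locs A)"


section \<open>Valuations\<close>

text \<open>Valuations are extensional functions, so that two valuations are equal iff they agree
  on the clocks (parameters) of the automaton.\<close>

type_synonym 'x cval = "'x \<Rightarrow> real"
type_synonym 'p pval = "'p \<Rightarrow> rat"

definition cvals :: "('a, 'l, 'x, 'p) pta \<Rightarrow> 'x cval set" where
  "cvals A = clocks A \<rightarrow>\<^sub>E {0..}"

definition pvals :: "('a, 'l, 'x, 'p) pta \<Rightarrow> 'p pval set" where
  "pvals A = params A \<rightarrow>\<^sub>E {0..}"

definition zero_val :: "('a, 'l, 'x, 'p) pta \<Rightarrow> 'x cval" where
  "zero_val A = (\<lambda>x \<in> clocks A. 0)"

definition delay :: "('a, 'l, 'x, 'p) pta \<Rightarrow> 'x cval \<Rightarrow> real \<Rightarrow> 'x cval" where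
  "delay A w d = (\<lambda>x \<in> clocks A. w x + d)"

definition reset_val :: "('a, 'l, 'x, 'p) pta \<Rightarrow> 'x set \<Rightarrow> 'x cval \<Rightarrow> 'x cval" where
  "reset_val A R w = (\<lambda>x \<in> clocks A. if x \<in> R then 0 else w x)"

fun atom_sat :: "'x cval \<Rightarrow> 'p pval \<Rightarrow> ('x, 'p) atom \<Rightarrow> bool" where
  "atom_sat w v (ClockParam x r p c) \<longleftrightarrow> compare r (w x) (of_rat (v p + c))"
| "atom_sat w v (ClockConst x r c) \<longleftrightarrow> compare r (w x) (of_rat c)"
| "atom_sat w v (ParamConst p r c) \<longleftrightarrow> compare r (of_rat (v p)) (of_rat c)"

text \<open>\<open>sat w v C\<close> says that \<open>w\<close> satisfies the constraint \<open>v(C)\<close>, in which every parameter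
  has been replaced by its value under \<open>v\<close>.\<close>

definition sat :: "'x cval \<Rightarrow> 'p pval \<Rightarrow> ('x, 'p) constr \<Rightarrow> bool" where
  "sat w v C \<longleftrightarrow> (\<forall>t \<in> set C. atom_sat w v t)"


section \<open>Concrete semantics\<close>

text \<open>In the symbolic semantics below, the invariant of a location is imposed after time
  elapsing only.  The concrete semantics of invariants agrees with this: the invariant of the
  source location holds when the location is left, and a location may be entered only if its
  invariant holds now or after some delay.  For invariants that bound clocks only from above,
  this is the semantics in which the invariant holds throughout the stay in the location
  (lemmas \<open>invar_throughout\<close> and \<open>admissible_upper\<close>).  With lower bounds, insisting on the
  invariant already on entry would not match the symbolic semantics: for the initial invariant
  \<open>x \<ge> p\<close>, the initial symbolic state is compatible with every parameter valuation, but the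
  state with \<open>x = 0\<close> satisfies the invariant only for \<open>p = 0\<close>.\<close>

type_synonym ('l, 'x) state = "'l \<times> 'x cval"

definition admissible :: "('a, 'l, 'x, 'p) pta \<Rightarrow> 'p pval \<Rightarrow> ('l, 'x) state \<Rightarrow> bool" where
  "admissible A v = (\<lambda>(l, w). \<exists>d \<ge> 0. sat (delay A w d) v (invar A l))"

fun step :: "('a, 'l, 'x, 'p) pta \<Rightarrow> 'p pval \<Rightarrow> ('l, 'x) state \<Rightarrow>
    real \<Rightarrow> ('a, 'l, 'x, 'p) edge \<Rightarrow> ('l, 'x) state \<Rightarrow> bool" where
  "step A v (l, w) d (k, g, a, R, k') (l', w') \<longleftrightarrow>
     (k, g, a, R, k') \<in> edges A \<and> l = k \<and> l' = k' \<and> d \<ge> 0 \<and>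
     sat (delay A w d) v (invar A l) \<and> sat (delay A w d) v g \<and>
     w' = reset_val A R (delay A w d) \<and> admissible A v (l', w')"

text \<open>A run with \<open>N\<close> steps, where \<open>N\<close> is possibly infinite; only the entries \<open>s i\<close> for \<open>i \<le> N\<close>
  and \<open>d i\<close>, \<open>e i\<close> for \<open>i < N\<close> are meaningful.

  Finite runs are not required to end in a deadlock, so the runs comprise all maximal ones
  (infinite or deadlocked) and their finite prefixes.  The trace sets of the deadlocked and
  infinite runs alone are not determined by the symbolic states.  Take one clock \<open>x\<close>, which is
  never reset, trivial invariants, and two edges: from \<open>l0\<close> to \<open>l1\<close> with action \<open>a\<close> and guard
  \<open>x \<le> 1\<close>, and from \<open>l1\<close> to \<open>l2\<close> with action \<open>b\<close> and guard \<open>x \<le> p\<close>.  All three symbolic states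
  are compatible with all values of \<open>p\<close>.  For \<open>p = 0\<close> there is a run with action \<open>a\<close> at time 1
  that deadlocks in \<open>l1\<close>; for \<open>p = 2\<close> every run that reaches \<open>l1\<close> can go on to \<open>l2\<close>.\<close>

definition is_run :: "('a, 'l, 'x, 'p) pta \<Rightarrow> 'p pval \<Rightarrow> enat \<Rightarrow> (nat \<Rightarrow> ('l, 'x) state) \<Rightarrow>
    (nat \<Rightarrow> real) \<Rightarrow> (nat \<Rightarrow> ('a, 'l, 'x, 'p) edge) \<Rightarrow> bool" where
  "is_run A v N s d e \<longleftrightarrow>
     s 0 = (loc0 A, zero_val A) \<and> admissible A v (s 0) \<and>
     (\<forall>i. enat i < N \<longrightarrow> step A v (s i) (d i) (e i) (s (Suc i)))"

fun action :: "('a, 'l, 'x, 'p) edge \<Rightarrow> 'a" where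
  "action (l, g, a, R, l') = a"

text \<open>The sequence of the pairs \<open>(l\<^sub>i, a\<^sub>i)\<close> for \<open>i < N\<close>, as a partial function on the indices.\<close>

definition trace :: "enat \<Rightarrow> (nat \<Rightarrow> ('l, 'x) state) \<Rightarrow> (nat \<Rightarrow> ('a, 'l, 'x, 'p) edge) \<Rightarrow>
    nat \<Rightarrow> ('l \<times> 'a) option" where
  "trace N s e = (\<lambda>i. if enat i < N then Some (fst (s i), action (e i)) else None)"

definition Traces :: "('a, 'l, 'x, 'p) pta \<Rightarrow> 'p pval \<Rightarrow> (nat \<Rightarrow> ('l \<times> 'a) option) set" where
  "Traces A v = {trace N s e | N s d e. is_run A v N s d e}"

fun upper_atom :: "('x, 'p) atom \<Rightarrow> bool" where
  "upper_atom (ClockParam x r p c) \<longleftrightarrow> r \<in> {Lt, Le}"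
| "upper_atom (ClockConst x r c) \<longleftrightarrow> r \<in> {Lt, Le}"
| "upper_atom (ParamConst p r c) \<longleftrightarrow> True"

lemma invar_throughout:
  assumes "constr_over (clocks A) P C" and "\<forall>t \<in> set C. upper_atom t"
    and "sat (delay A w d) v C" and "d' \<le> d"
  shows "sat (delay A w d') v C"
  unfolding sat_def
proof
  fix t assume t: "t \<in> set C"
  have "atom_over (clocks A) P t" "upper_atom t" "atom_sat (delay A w d) v t"
    using assms t by (auto simp: constr_over_def sat_def)
  then show "atom_sat (delay A w d') v t"
    using \<open>d' \<le> d\<close> by (cases t) (auto simp: delay_def)
qed

lemma admissible_upper:
  assumes "constr_over (clocks A) P (invar A l)" and "\<forall>t \<in> set (invar A l). upper_atom t"
    and "w \<in> cvals A"
  shows "admissible A v (l, w) \<longleftrightarrow> sat w v (invar A l)"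
proof -
  have "delay A w 0 = w"
    using \<open>w \<in> cvals A\<close> by (auto simp: delay_def cvals_def fun_eq_iff PiE_def extensional_def)
  then show ?thesis
    using invar_throughout[OF assms(1,2), of w _ v 0] by (auto simp: admissible_def)
qed


section \<open>Symbolic semantics\<close>

text \<open>A constraint over clocks and parameters is represented by the set of pairs of valuations
  that satisfy it, a constraint over parameters by a set of parameter valuations.  Hence
  equality of symbolic states is equality up to equivalence of constraints.\<close>

type_synonym ('x, 'p) zone = "('x cval \<times> 'p pval) set"
type_synonym ('l, 'x, 'p) sym_state = "'l \<times> ('x, 'p) zone"

definition zone_of :: "('a, 'l, 'x, 'p) pta \<Rightarrow> ('x, 'p) constr \<Rightarrow> ('x, 'p) zone" where
  "zone_of A C = {(w, v). w \<in> cvals A \<and> v \<in> pvals A \<and> sat w v C}"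

definition elapse :: "('a, 'l, 'x, 'p) pta \<Rightarrow> ('x, 'p) zone \<Rightarrow> ('x, 'p) zone" where
  "elapse A C = {(delay A w d, v) | w v d. (w, v) \<in> C \<and> d \<ge> 0}"

definition reset :: "('a, 'l, 'x, 'p) pta \<Rightarrow> 'x set \<Rightarrow> ('x, 'p) zone \<Rightarrow> ('x, 'p) zone" where
  "reset A R C = {(reset_val A R w, v) | w v. (w, v) \<in> C}"

definition proj :: "('x, 'p) zone \<Rightarrow> 'p pval set" where
  "proj C = {v. \<exists>w. (w, v) \<in> C}"

definition sym_init :: "('a, 'l, 'x, 'p) pta \<Rightarrow> ('l, 'x, 'p) sym_state" where
  "sym_init A = (loc0 A, elapse A ({zero_val A} \<times> pvals A) \<inter> zone_of A (invar A (loc0 A)))"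

fun Succ_edge :: "('a, 'l, 'x, 'p) pta \<Rightarrow> ('a, 'l, 'x, 'p) edge \<Rightarrow>
    ('l, 'x, 'p) sym_state \<Rightarrow> ('l, 'x, 'p) sym_state set" where
  "Succ_edge A (k, g, a, R, k') (l, C) =
     (let C' = elapse A (reset A R (C \<inter> zone_of A g)) \<inter> zone_of A (invar A k')
      in if l = k \<and> C' \<noteq> {} then {(k', C')} else {})"

definition Succ :: "('a, 'l, 'x, 'p) pta \<Rightarrow>
    ('l, 'x, 'p) sym_state set \<Rightarrow> ('l, 'x, 'p) sym_state set" where
  "Succ A S = (\<Union>s \<in> S. \<Union>e \<in> edges A. Succ_edge A e s)"


section \<open>The algorithm\<close>

definition compatible :: "'p pval \<Rightarrow> ('l, 'x, 'p) sym_state \<Rightarrow> bool" where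
  "compatible v = (\<lambda>(l, C). v \<in> proj C)"

definition good :: "'p pval \<Rightarrow> ('l, 'x, 'p) sym_state set \<Rightarrow> ('l, 'x, 'p) sym_state set" where
  "good v S = {s \<in> S. compatible v s}"

definition bad :: "'p pval \<Rightarrow> ('l, 'x, 'p) sym_state set \<Rightarrow> ('l, 'x, 'p) sym_state set" where
  "bad v S = {s \<in> S. \<not> compatible v s}"

definition upd_good :: "'p pval \<Rightarrow> ('l, 'x, 'p) sym_state set \<Rightarrow> 'p pval set \<Rightarrow> 'p pval set" where
  "upd_good v S K = K \<inter> (\<Inter>(l, C) \<in> good v S. proj C)"

definition upd_bad :: "'p pval \<Rightarrow> ('l, 'x, 'p) sym_state set \<Rightarrow> 'p pval set \<Rightarrow> 'p pval set" where
  "upd_bad v S K = K \<union> (\<Union>(l, C) \<in> bad v S. proj C)"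

text \<open>\<open>TPS_loop A v Kgood Kbad Snew S K\<close>: with the variables having the given values at the start
  of an iteration, the loop terminates after finitely many iterations and returns \<open>K\<close>.\<close>

inductive TPS_loop :: "('a, 'l, 'x, 'p) pta \<Rightarrow> 'p pval \<Rightarrow> 'p pval set \<Rightarrow> 'p pval set \<Rightarrow>
    ('l, 'x, 'p) sym_state set \<Rightarrow> ('l, 'x, 'p) sym_state set \<Rightarrow> 'p pval set \<Rightarrow> bool"
  for A v where
  return: "good v Snew \<subseteq> S \<Longrightarrow>
    TPS_loop A v Kgood Kbad Snew S (upd_good v Snew Kgood - upd_bad v Snew Kbad)"
| iterate: "\<not> good v Snew \<subseteq> S \<Longrightarrow>
    TPS_loop A v (upd_good v Snew Kgood) (upd_bad v Snew Kbad)
      (Succ A (good v Snew)) (S \<union> good v Snew) K \<Longrightarrow>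
    TPS_loop A v Kgood Kbad Snew S K"

definition TPS :: "('a, 'l, 'x, 'p) pta \<Rightarrow> 'p pval \<Rightarrow> 'p pval set \<Rightarrow> bool" where
  "TPS A v K \<longleftrightarrow> TPS_loop A v (pvals A) {} {sym_init A} {} K"

end

theory Submission
  imports Defs "HOL-Library.Diagonal_Subsequence"
begin

text \<open>
  A parameter valuation admits a finite run along a given edge sequence iff it lies in the
  projection of the zone computed along that sequence.  Since every symbolic state reachable
  through compatible ones is explored, and \<open>K\<close> lies inside the projections of the compatible
  states and outside those of the incompatible ones, all valuations in \<open>K\<close> admit finite runs
  along the same edge sequences.

  For infinite runs it remains to see that an edge sequence all of whose prefixes are realizable
  is itself realizable.  In terms of the times \<open>t i\<close> at which the edges are taken, this is
  a compactness property of systems of constraints \<open>t i - t j \<sim> q\<close>, where \<open>q\<close> ranges over finitely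
  many rationals.  Limits do not preserve strict inequalities, so the solution is not taken as
  a limit of real numbers.  After scaling, all \<open>q\<close> are integers, and delays beyond the largest of
  them can be cut down to bound each time.  A constraint then depends only on the integer parts of
  the times and on the order of their fractional parts; both stabilize along a subsequence, and the
  limit order of the fractional parts is embedded into \<open>[0, 1)\<close>.
\<close>

section \<open>Compactness of difference constraints\<close>

lemma dyadic_weight_strict_mono:
  fixes A B :: "nat set"
  assumes "A \<subset> B"
  shows "(\<Sum>n. if n \<in> A then (1/2) ^ Suc n else 0) < (\<Sum>n. if n \<in> B then (1/2) ^ Suc n else 0 :: real)"
proof -
  have sm: "summable (\<lambda>n. if n \<in> C then (1/2) ^ Suc n else 0 :: real)" for C :: "nat set"
    by (rule summable_comparison_test'[OF sums_summable[OF power_half_series], of 0]) auto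
  obtain k where k: "k \<in> B" "k \<notin> A" using assms by auto
  \<comment> \<open>Distinct sets may have equal binary expansions, but for
    \<open>A \<subset> B\<close> all termwise differences are nonnegative and the one at
    \<open>k\<close> is positive.\<close>
  have "0 < (\<Sum>n. (if n \<in> B then (1/2) ^ Suc n else 0) - (if n \<in> A then (1/2) ^ Suc n else 0 :: real))"
    by (rule suminf_pos2[where i = k]) (use assms k in \<open>auto intro: summable_diff[OF sm sm]\<close>)
  also have "\<dots> = (\<Sum>n. if n \<in> B then (1/2) ^ Suc n else 0) - (\<Sum>n. if n \<in> A then (1/2) ^ Suc n else 0 :: real)"
    by (rule suminf_diff[symmetric]) (rule sm)+
  finally show ?thesis by simp
qed

text \<open>Each \<open>i\<close> is sent to the dyadic weight of its set of strict predecessors. By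
  \<open>negtrans\<close> these sets form a chain under inclusion, and by \<open>irrefl\<close> none
  of them is all of the naturals, which keeps the weights below 1.\<close>

lemma weak_order_embedding:
  fixes lt :: "nat \<Rightarrow> nat \<Rightarrow> bool"
  assumes irrefl: "\<And>i. \<not> lt i i"
    and trans: "\<And>i j k. lt i j \<Longrightarrow> lt j k \<Longrightarrow> lt i k"
    and negtrans: "\<And>i j k. lt i j \<Longrightarrow> lt i k \<or> lt k j"
  shows "\<exists>\<phi> :: nat \<Rightarrow> real. (\<forall>i. 0 \<le> \<phi> i \<and> \<phi> i < 1) \<and> (\<forall>i j. \<phi> i < \<phi> j \<longleftrightarrow> lt i j)"
proof -
  define h :: "nat set \<Rightarrow> real" where "h = (\<lambda>A. \<Sum>n. if n \<in> A then (1/2) ^ Suc n else 0)"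
  have h_less: "h A < h B" if "A \<subset> B" for A B
    using dyadic_weight_strict_mono[OF that] by (simp add: h_def)
  have h_le: "h A \<le> h B" if "A \<subseteq> B" for A B
    using h_less[of A B] that by (cases "A = B") (simp_all add: psubset_eq less_imp_le)
  have h0: "h {} = 0" by (simp add: h_def)
  have h1: "h UNIV = 1" using sums_unique[OF power_half_series] by (simp add: h_def)
  show ?thesis
  proof (intro exI[of _ "\<lambda>i. h {l. lt l i}"] conjI allI)
    show "0 \<le> h {l. lt l i}" for i using h_le[of "{}"] h0 by auto
    show "h {l. lt l i} < 1" for i using h_less[of "{l. lt l i}" UNIV] h1 irrefl[of i] by auto
    show "h {l. lt l i} < h {l. lt l j} \<longleftrightarrow> lt i j" for i j
    proof (cases "lt i j")
      case True
      then have "{l. lt l i} \<subset> {l. lt l j}" using trans irrefl by blast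
      then show ?thesis using h_less True by simp
    next
      case False
      then have "{l. lt l j} \<subseteq> {l. lt l i}" using negtrans by blast
      then show ?thesis using h_le False by (simp add: not_less)
    qed
  qed
qed

section \<open>Diagonal argument and integer constraints on bounded times\<close>

lemma subseq_all_eventually_const:
  fixes F :: "nat \<Rightarrow> nat \<Rightarrow> 'b"
  assumes fin: "\<And>k. finite (range (F k))"
  obtains r where "strict_mono (r :: nat \<Rightarrow> nat)" "\<And>k n. k < n \<Longrightarrow> F k (r n) = F k (r (Suc k))"
proof -
  interpret subseqs "\<lambda>k s. \<forall>n. F k (s n) = F k (s 0)"
  proof
    fix k and s :: "nat \<Rightarrow> nat"
    have "finite ((F k \<circ> s) ` UNIV)"
      by (rule finite_subset[OF _ fin[of k]]) auto
    then obtain a where a: "infinite {n \<in> UNIV. (F k \<circ> s) n = (F k \<circ> s) a}"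
      using pigeonhole_infinite[of UNIV "F k \<circ> s"] by auto
    obtain r where r: "strict_mono (r :: nat \<Rightarrow> nat)" "\<And>n. r n \<in> {n \<in> UNIV. (F k \<circ> s) n = (F k \<circ> s) a}"
      using infinite_enumerate[OF a] by auto
    have "F k ((s \<circ> r) n) = F k ((s \<circ> r) 0)" for n
      using r(2)[of n] r(2)[of 0] by simp
    then show "\<exists>r :: nat \<Rightarrow> nat. strict_mono r \<and> (\<forall>n. F k ((s \<circ> r) n) = F k ((s \<circ> r) 0))"
      using r(1) by (intro exI[of _ r]) simp
  qed
  \<comment> \<open>From index \<open>Suc k\<close> on, the diagonal sequence is a subsequence of
    the one on which \<open>F k\<close> was made constant, and constancy passes to
    subsequences.\<close>
  have "\<forall>n. F k ((diagseq \<circ> (+) (Suc k)) n) = F k ((diagseq \<circ> (+) (Suc k)) 0)" for k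
  proof (rule diagseq_holds)
    fix s' r' :: "nat \<Rightarrow> nat" and m
    assume "\<forall>n. F m (s' n) = F m (s' 0)"
    from spec[OF this] show "\<forall>n. F m ((s' \<circ> r') n) = F m ((s' \<circ> r') 0)" by (metis comp_apply)
  qed
  then have shift: "F k (diagseq (Suc k + m)) = F k (diagseq (Suc k))" for k m by simp
  show ?thesis
  proof (rule that[OF subseq_diagseq])
    show "F k (diagseq n) = F k (diagseq (Suc k))" if "k < n" for k n
      using shift[of k "n - Suc k"] that by simp
  qed
qed

text \<open>Fractional parts differ by less than 1, so they matter only if the integer parts differ
  by exactly \<open>k\<close>. The right-hand sides use nothing but integer parts and the strict
  order of fractional parts, the data that survive the limit.\<close>

lemma diff_compare_int_iff:
  fixes a b :: real and k :: int
  shows "a - b < of_int k \<longleftrightarrow> \<lfloor>a\<rfloor> - \<lfloor>b\<rfloor> < k \<or> (\<lfloor>a\<rfloor> - \<lfloor>b\<rfloor> = k \<and> frac a < frac b)"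
    and "a - b = of_int k \<longleftrightarrow> \<lfloor>a\<rfloor> - \<lfloor>b\<rfloor> = k \<and> \<not> frac a < frac b \<and> \<not> frac b < frac a"
proof -
  have a: "a = of_int \<lfloor>a\<rfloor> + frac a" and b: "b = of_int \<lfloor>b\<rfloor> + frac b" by (simp_all add: frac_def)
  have fr: "0 \<le> frac a" "frac a < 1" "0 \<le> frac b" "frac b < 1" by (simp_all add: frac_lt_1)
  define m where "m = \<lfloor>a\<rfloor> - \<lfloor>b\<rfloor>"
  have d: "a - b = of_int m + (frac a - frac b)" using a b by (simp add: m_def)
  consider "m \<le> k - 1" | "m = k" | "m \<ge> k + 1" by linarith
  then have "(a - b < of_int k \<longleftrightarrow> m < k \<or> (m = k \<and> frac a < frac b)) \<and>
    (a - b = of_int k \<longleftrightarrow> m = k \<and> \<not> frac a < frac b \<and> \<not> frac b < frac a)"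
  proof cases
    case 1
    then have "real_of_int m \<le> of_int k - 1" by linarith
    then have "a - b < of_int k" using d fr by linarith
    then show ?thesis using 1 by simp
  next
    case 2
    then show ?thesis using d fr 2 by auto
  next
    case 3
    then have "real_of_int m \<ge> of_int k + 1" by linarith
    then have "a - b > of_int k" using d fr by linarith
    then show ?thesis using 3 by simp
  qed
  then show "a - b < of_int k \<longleftrightarrow> \<lfloor>a\<rfloor> - \<lfloor>b\<rfloor> < k \<or> (\<lfloor>a\<rfloor> - \<lfloor>b\<rfloor> = k \<and> frac a < frac b)"
    and "a - b = of_int k \<longleftrightarrow> \<lfloor>a\<rfloor> - \<lfloor>b\<rfloor> = k \<and> \<not> frac a < frac b \<and> \<not> frac b < frac a"
    by (simp_all add: m_def)
qed

text \<open>\<open>F k n\<close> plays the role of a clock region for the times \<open>T n 0\<close>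
  to \<open>T n k\<close>. The bounds leave finitely many regions for each \<open>k\<close>, so a
  diagonal subsequence stabilizes all of them.\<close>

lemma bounded_int_difference_compactness:
  fixes T :: "nat \<Rightarrow> nat \<Rightarrow> real"
  assumes bounded: "\<And>n i. \<bar>T n i\<bar> \<le> b i"
  obtains t :: "nat \<Rightarrow> real" where "\<And>m. \<exists>n \<ge> m. \<forall>i \<le> m. \<forall>j \<le> m. \<forall>k :: int.
      (t i - t j < of_int k \<longleftrightarrow> T n i - T n j < of_int k) \<and>
      (t i - t j = of_int k \<longleftrightarrow> T n i - T n j = of_int k)"
proof -
  define F where "F = (\<lambda>k n. (\<lambda>i \<in> {..k}. \<lfloor>T n i\<rfloor>,
    {(i, j). i \<le> k \<and> j \<le> k \<and> frac (T n i) < frac (T n j)}))"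
  have "finite (range (F k))" for k
  proof (rule finite_subset)
    have "\<lfloor>T n i\<rfloor> \<in> {\<lfloor>- b i\<rfloor>..\<lfloor>b i\<rfloor>}" for n i
      using bounded[of n i] by (auto intro!: floor_mono)
    then show "range (F k) \<subseteq> (\<Pi>\<^sub>E i \<in> {..k}. {\<lfloor>- b i\<rfloor>..\<lfloor>b i\<rfloor>}) \<times> Pow ({..k} \<times> {..k})"
      by (auto simp: F_def PiE_def)
    show "finite ((\<Pi>\<^sub>E i \<in> {..k}. {\<lfloor>- b i\<rfloor>..\<lfloor>b i\<rfloor>}) \<times> Pow ({..k} \<times> {..k}))"
      by (intro finite_cartesian_product finite_PiE) auto
  qed
  then obtain r where r: "strict_mono r" "\<And>k n. k < n \<Longrightarrow> F k (r n) = F k (r (Suc k))"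
    using subseq_all_eventually_const[of F] by blast
  \<comment> \<open>The shift makes \<open>F k\<close> constant along \<open>N\<close> from index
    \<open>k\<close> itself.\<close>
  define N where "N k = r (Suc k)" for k
  have N_ge: "k \<le> N k" for k
    using strict_mono_imp_increasing[OF r(1), of "Suc k"] by (simp add: N_def)
  have F_N: "F k (N k') = F k (N k)" if "k \<le> k'" for k k'
    using r(2)[of k "Suc k'"] that by (simp add: N_def)
  have floor_N: "\<lfloor>T (N k') i\<rfloor> = \<lfloor>T (N k) i\<rfloor>" if "i \<le> k" "k \<le> k'" for i k k'
    using fun_cong[OF arg_cong[OF F_N[OF that(2)], of fst], of i] that by (simp add: F_def)
  have frac_N: "frac (T (N k') i) < frac (T (N k') j) \<longleftrightarrow> frac (T (N k) i) < frac (T (N k) j)"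
    if "i \<le> k" "j \<le> k" "k \<le> k'" for i j k k'
  proof -
    have "(i, j) \<in> snd (F k (N k')) \<longleftrightarrow> (i, j) \<in> snd (F k (N k))" using F_N[OF that(3)] by simp
    then show ?thesis using that by (simp add: F_def)
  qed
  \<comment> \<open>\<open>max i j\<close> is the first stage whose region covers both indices; by
    \<open>lt_iff\<close> every later stage gives the same order.\<close>
  define lt where "lt i j \<longleftrightarrow> frac (T (N (max i j)) i) < frac (T (N (max i j)) j)" for i j
  have lt_iff: "lt i j \<longleftrightarrow> frac (T (N k) i) < frac (T (N k) j)" if "i \<le> k" "j \<le> k" for i j k
    using frac_N[of i "max i j" j k] that by (simp add: lt_def)
  have irrefl: "\<not> lt i i" for i by (simp add: lt_def)
  have trans: "lt i l" if "lt i j" "lt j l" for i j l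
  proof -
    define k where "k = max i (max j l)"
    have k: "i \<le> k" "j \<le> k" "l \<le> k" by (simp_all add: k_def)
    show ?thesis
      using that unfolding lt_iff[OF k(1,2)] lt_iff[OF k(2,3)] lt_iff[OF k(1,3)] by (rule less_trans)
  qed
  have negtrans: "lt i l \<or> lt l j" if "lt i j" for i j l
  proof -
    define k where "k = max i (max j l)"
    have k: "i \<le> k" "j \<le> k" "l \<le> k" by (simp_all add: k_def)
    show ?thesis
      using that unfolding lt_iff[OF k(1,2)] lt_iff[OF k(1,3)] lt_iff[OF k(3,2)] by linarith
  qed
  have "\<exists>\<phi> :: nat \<Rightarrow> real. (\<forall>i. 0 \<le> \<phi> i \<and> \<phi> i < 1) \<and> (\<forall>i j. \<phi> i < \<phi> j \<longleftrightarrow> lt i j)"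
    by (rule weak_order_embedding) (fact irrefl, erule (1) trans, erule negtrans)
  then obtain \<phi> :: "nat \<Rightarrow> real" where \<phi>: "\<And>i. 0 \<le> \<phi> i" "\<And>i. \<phi> i < 1" "\<And>i j. \<phi> i < \<phi> j \<longleftrightarrow> lt i j"
    by (elim exE conjE) auto
  define t where "t i = of_int \<lfloor>T (N i) i\<rfloor> + \<phi> i" for i
  have floor_t: "\<lfloor>t i\<rfloor> = \<lfloor>T (N i) i\<rfloor>" for i
    using \<phi>(1,2)[of i] by (simp add: t_def floor_unique)
  have frac_t: "frac (t i) = \<phi> i" for i
    using floor_t[of i] by (simp add: frac_def t_def)
  show ?thesis
  proof (rule that[of t])
    fix m
    show "\<exists>n \<ge> m. \<forall>i \<le> m. \<forall>j \<le> m. \<forall>k :: int.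
      (t i - t j < of_int k \<longleftrightarrow> T n i - T n j < of_int k) \<and>
      (t i - t j = of_int k \<longleftrightarrow> T n i - T n j = of_int k)"
    proof (intro exI[of _ "N m"] conjI[OF N_ge] allI impI)
      fix i j and k :: int
      assume ij: "i \<le> m" "j \<le> m"
      have "\<lfloor>t i\<rfloor> = \<lfloor>T (N m) i\<rfloor>" "\<lfloor>t j\<rfloor> = \<lfloor>T (N m) j\<rfloor>"
        using floor_N[of i i m] floor_N[of j j m] ij by (simp_all add: floor_t)
      moreover have "frac (t i) < frac (t j) \<longleftrightarrow> frac (T (N m) i) < frac (T (N m) j)"
        "frac (t j) < frac (t i) \<longleftrightarrow> frac (T (N m) j) < frac (T (N m) i)"
        by (simp_all add: frac_t \<phi>(3) lt_iff ij)
      ultimately show "(t i - t j < of_int k \<longleftrightarrow> T (N m) i - T (N m) j < of_int k) \<and>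
        (t i - t j = of_int k \<longleftrightarrow> T (N m) i - T (N m) j = of_int k)"
        by (simp only: diff_compare_int_iff)
    qed
  qed
qed

section \<open>Rational constants and unbounded times\<close>

lemma common_denominator:
  fixes Q :: "real set"
  assumes "finite Q" "Q \<subseteq> \<rat>"
  obtains D :: real where "D > 0" "\<And>q. q \<in> Q \<Longrightarrow> D * q \<in> \<int>"
proof -
  \<comment> \<open>Integrality of \<open>D\<close> is carried along so that \<open>D\<close> times
    the numerator of a newly inserted rational is again an integer.\<close>
  have "\<exists>D :: real. D > 0 \<and> D \<in> \<int> \<and> (\<forall>q \<in> Q. D * q \<in> \<int>)"
    using assms
  proof (induction Q)
    case empty
    show ?case by (intro exI[of _ 1]) auto
  next
    case (insert q Q)
    then obtain D :: real where D: "D > 0" "D \<in> \<int>" "\<forall>q \<in> Q. D * q \<in> \<int>" by auto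
    from insert.prems have "q \<in> \<rat>" by simp
    then obtain a b where q: "q = of_int a / of_int b" "b > 0"
      by (elim Rats_cases') auto
    show ?case
    proof (intro exI[of _ "D * of_int b"] conjI ballI)
      show "D * of_int b > 0" "D * of_int b \<in> \<int>" using D q by auto
      fix p assume "p \<in> insert q Q"
      then consider "p = q" | "p \<in> Q" by auto
      then show "D * of_int b * p \<in> \<int>"
      proof cases
        case 1
        then have "D * of_int b * p = D * of_int a" using q by simp
        also have "\<dots> \<in> \<int>" using D(2) by (intro Ints_mult) auto
        finally show ?thesis .
      next
        case 2
        have "D * of_int b * p = (D * p) * of_int b" by simp
        also have "\<dots> \<in> \<int>" using D(3) 2 by (intro Ints_mult[OF _ Ints_of_int]) blast
        finally show ?thesis .
      qed
    qed
  qed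
  then show ?thesis using that by blast
qed

text \<open>While no increment is cut, the two differences agree. Once one is cut, both differences
  are at least \<open>B\<close>, and they stay so since the increments are nonnegative.\<close>

lemma capped_increments:
  fixes f :: "nat \<Rightarrow> real"
  assumes "mono f" "0 \<le> B" "j \<le> i"
  defines "u \<equiv> \<lambda>i. \<Sum>k<i. min B (f (Suc k) - f k)"
  shows "u i - u j = f i - f j \<or> (B \<le> u i - u j \<and> B \<le> f i - f j)"
  using assms(3)
proof (induction i rule: dec_induct)
  case base
  show ?case by simp
next
  case (step i)
  have "f i \<le> f (Suc i)" using assms(1) by (simp add: mono_iff_le_Suc)
  moreover have "f j \<le> f i" using assms(1) step(1) by (simp add: monoD)
  moreover have "u (Suc i) = u i + min B (f (Suc i) - f i)" by (simp add: u_def)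
  ultimately show ?case using step.IH assms(2) by (auto simp: min_def)
qed

lemma difference_compactness:
  fixes T :: "nat \<Rightarrow> nat \<Rightarrow> real"
  assumes mono: "\<And>n. mono (T n)" and Q: "finite Q" "Q \<subseteq> \<rat>"
  shows "\<exists>t :: nat \<Rightarrow> real. mono t \<and> (\<forall>m. \<exists>n \<ge> m. \<forall>i \<le> m. \<forall>j \<le> i. \<forall>q \<in> Q.
      (t i - t j < q \<longleftrightarrow> T n i - T n j < q) \<and> (t i - t j = q \<longleftrightarrow> T n i - T n j = q))"
proof -
  obtain D where D: "D > 0" "\<And>q. q \<in> Q \<Longrightarrow> D * q \<in> \<int>"
    using common_denominator[OF Q] by blast
  \<comment> \<open>Inserting 0 covers empty \<open>Q\<close> and makes \<open>B\<close>
    nonnegative; adding 1 puts \<open>B\<close> strictly above every scaled constant.\<close>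
  define B where "B = Max (insert 0 ((\<lambda>q. D * q) ` Q)) + 1"
  have "0 \<le> Max (insert 0 ((\<lambda>q. D * q) ` Q))" "\<And>q. q \<in> Q \<Longrightarrow> D * q \<le> Max (insert 0 ((\<lambda>q. D * q) ` Q))"
    using Q(1) by (auto intro!: Max_ge)
  then have B: "0 \<le> B" "\<And>q. q \<in> Q \<Longrightarrow> D * q < B" by (force simp: B_def)+
  have mono': "mono (\<lambda>i. D * T n i)" for n
    using mono D(1) by (auto simp: mono_def)
  define U where "U n i = (\<Sum>k<i. min B (D * T n (Suc k) - D * T n k))" for n i
  have U_diff: "U n i - U n j = D * T n i - D * T n j \<or>
      (B \<le> U n i - U n j \<and> B \<le> D * T n i - D * T n j)" if "j \<le> i" for n i j
    using capped_increments[OF mono' B(1) that] by (simp add: U_def)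
  have inc: "0 \<le> min B (D * T n (Suc k) - D * T n k)" for n k
    using mono'[of n] B(1) by (simp add: mono_iff_le_Suc)
  have "\<bar>U n i\<bar> \<le> real i * B" for n i
  proof -
    have "0 \<le> U n i" unfolding U_def by (intro sum_nonneg inc)
    moreover have "U n i \<le> real i * B"
      unfolding U_def using sum_bounded_above[of "{..<i}" _ B] by simp
    ultimately show ?thesis by simp
  qed
  then obtain t :: "nat \<Rightarrow> real" where t: "\<And>m. \<exists>n \<ge> m. \<forall>i \<le> m. \<forall>j \<le> m. \<forall>k :: int.
      (t i - t j < of_int k \<longleftrightarrow> U n i - U n j < of_int k) \<and>
      (t i - t j = of_int k \<longleftrightarrow> U n i - U n j = of_int k)"
    using bounded_int_difference_compactness[of U "\<lambda>i. real i * B"] by blast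
  show ?thesis
  proof (intro exI[of _ "\<lambda>i. t i / D"] conjI allI)
    have "t i \<le> t (Suc i)" for i
    proof -
      obtain n where "\<forall>k :: int. (t (Suc i) - t i < of_int k \<longleftrightarrow> U n (Suc i) - U n i < of_int k)"
        using t[of "Suc i"] by (meson le_SucI order_refl)
      \<comment> \<open>The integer constant 0 yields monotonicity of \<open>t\<close>: no increment
        of \<open>U n\<close> is negative.\<close>
      from this[rule_format, of 0] show ?thesis using inc[of n i] by (simp add: U_def)
    qed
    then show "mono (\<lambda>i. t i / D)" using D(1) by (simp add: mono_iff_le_Suc divide_right_mono)
  next
    fix m
    obtain n where n: "n \<ge> m" "\<forall>i \<le> m. \<forall>j \<le> m. \<forall>k :: int.
      (t i - t j < of_int k \<longleftrightarrow> U n i - U n j < of_int k) \<and>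
      (t i - t j = of_int k \<longleftrightarrow> U n i - U n j = of_int k)"
      using t by blast
    show "\<exists>n \<ge> m. \<forall>i \<le> m. \<forall>j \<le> i. \<forall>q \<in> Q.
      (t i / D - t j / D < q \<longleftrightarrow> T n i - T n j < q) \<and> (t i / D - t j / D = q \<longleftrightarrow> T n i - T n j = q)"
    proof (intro exI[of _ n] conjI[OF n(1)] allI impI ballI)
      fix i j q assume ij: "i \<le> m" "j \<le> i" and q: "q \<in> Q"
      obtain k where k: "D * q = of_int k" using D(2)[OF q] by (auto elim: Ints_cases)
      have "(t i - t j < D * q \<longleftrightarrow> U n i - U n j < D * q) \<and> (t i - t j = D * q \<longleftrightarrow> U n i - U n j = D * q)"
        using n(2) ij by (simp add: k)
      \<comment> \<open>Where capping changes a difference, both versions are at least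
        \<open>B > D * q\<close>, so both comparisons fail on either side.\<close>
      moreover have "(U n i - U n j < D * q \<longleftrightarrow> D * T n i - D * T n j < D * q) \<and>
          (U n i - U n j = D * q \<longleftrightarrow> D * T n i - D * T n j = D * q)"
        using U_diff[OF ij(2), of n] B(2)[OF q] by linarith
      moreover have "D * T n i - D * T n j = D * (T n i - T n j)" by (simp add: algebra_simps)
      moreover have "t i / D - t j / D < q \<longleftrightarrow> t i - t j < D * q" "t i / D - t j / D = q \<longleftrightarrow> t i - t j = D * q"
        using D(1) by (auto simp: field_simps)
      ultimately show "(t i / D - t j / D < q \<longleftrightarrow> T n i - T n j < q) \<and>
          (t i / D - t j / D = q \<longleftrightarrow> T n i - T n j = q)"
        using D(1) by simp
    qed
  qed
qed

section \<open>Runs and edge sequences\<close>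

definition src :: "('a, 'l, 'x, 'p) edge \<Rightarrow> 'l" where "src = (\<lambda>(l, g, a, R, l'). l)"
definition guard :: "('a, 'l, 'x, 'p) edge \<Rightarrow> ('x, 'p) constr" where "guard = (\<lambda>(l, g, a, R, l'). g)"
definition resets :: "('a, 'l, 'x, 'p) edge \<Rightarrow> 'x set" where "resets = (\<lambda>(l, g, a, R, l'). R)"
definition tgt :: "('a, 'l, 'x, 'p) edge \<Rightarrow> 'l" where "tgt = (\<lambda>(l, g, a, R, l'). l')"

lemma step_iff:
  "step A v s d e s' \<longleftrightarrow> e \<in> edges A \<and> fst s = src e \<and> fst s' = tgt e \<and> d \<ge> 0 \<and>
     sat (delay A (snd s) d) v (invar A (src e)) \<and> sat (delay A (snd s) d) v (guard e) \<and>
     snd s' = reset_val A (resets e) (delay A (snd s) d) \<and> admissible A v s'"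
  by (cases s; cases s'; cases e) (auto simp: src_def guard_def resets_def tgt_def)

lemma Succ_edge_eq:
  "Succ_edge A e s =
     (let C' = elapse A (reset A (resets e) (snd s \<inter> zone_of A (guard e))) \<inter> zone_of A (invar A (tgt e))
      in if fst s = src e \<and> C' \<noteq> {} then {(tgt e, C')} else {})"
  by (cases s; cases e) (auto simp: src_def guard_def resets_def tgt_def Let_def)

fun loc_at :: "('a, 'l, 'x, 'p) pta \<Rightarrow> (nat \<Rightarrow> ('a, 'l, 'x, 'p) edge) \<Rightarrow> nat \<Rightarrow> 'l" where
  "loc_at A e 0 = loc0 A"
| "loc_at A e (Suc n) = tgt (e n)"

definition is_path :: "('a, 'l, 'x, 'p) pta \<Rightarrow> nat \<Rightarrow> (nat \<Rightarrow> ('a, 'l, 'x, 'p) edge) \<Rightarrow> bool" where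
  "is_path A n e \<longleftrightarrow> (\<forall>i < n. e i \<in> edges A \<and> src (e i) = loc_at A e i)"

lemma is_path_Suc: "is_path A (Suc n) e \<longleftrightarrow> is_path A n e \<and> e n \<in> edges A \<and> src (e n) = loc_at A e n"
  by (auto simp: is_path_def less_Suc_eq)

lemma run_loc:
  assumes "is_run A v N s d e" "enat n \<le> N"
  shows "fst (s n) = loc_at A e n"
proof (cases n)
  case 0
  then show ?thesis using assms by (simp add: is_run_def)
next
  case (Suc m)
  then have "enat m < N" using assms(2) by (simp add: Suc_ile_eq)
  then show ?thesis using assms Suc by (simp add: is_run_def step_iff)
qed

lemma run_is_path:
  assumes "is_run A v N s d e" "enat n \<le> N"
  shows "is_path A n e"
  unfolding is_path_def
proof (intro allI impI)
  fix i assume "i < n"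
  then have i: "enat i < N" using assms(2) by (meson enat_ord_simps(2) less_le_trans)
  then have "step A v (s i) (d i) (e i) (s (Suc i))" using assms(1) by (simp add: is_run_def)
  then show "e i \<in> edges A \<and> src (e i) = loc_at A e i"
    using run_loc[OF assms(1) less_imp_le[OF i]] by (simp add: step_iff)
qed

text \<open>The locations of a run are the sources of its edges, so valuations that realize the same
  edge sequences have the same traces.\<close>

lemma trace_run:
  assumes "is_run A v N s d e"
  shows "trace N s e = (\<lambda>i. if enat i < N then Some (src (e i), action (e i)) else None)"
  using assms by (auto simp: trace_def is_run_def step_iff fun_eq_iff)

lemma run_prefix:
  assumes "is_run A v N s d e" "M \<le> N"
  shows "is_run A v M s d e"
  using assms by (auto simp: is_run_def)

section \<open>Zones along an edge sequence\<close>

text \<open>The zones that \<open>Succ_edge\<close> computes along \<open>e\<close>, but without its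
  emptiness test, so that the function is total.\<close>

fun zone_at :: "('a, 'l, 'x, 'p) pta \<Rightarrow> (nat \<Rightarrow> ('a, 'l, 'x, 'p) edge) \<Rightarrow> nat \<Rightarrow> ('x, 'p) zone" where
  "zone_at A e 0 = snd (sym_init A)"
| "zone_at A e (Suc n) =
     elapse A (reset A (resets (e n)) (zone_at A e n \<inter> zone_of A (guard (e n)))) \<inter>
     zone_of A (invar A (tgt (e n)))"

lemma proj_zone_at_Suc: "v \<in> proj (zone_at A e (Suc n)) \<Longrightarrow> v \<in> proj (zone_at A e n)"
  by (auto simp: proj_def elapse_def reset_def)

lemma zone_at_imp_invar: "(u, v) \<in> zone_at A e n \<Longrightarrow> sat u v (invar A (loc_at A e n))"
  by (cases n) (auto simp: sym_init_def zone_of_def)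

lemma zero_val_cvals: "zero_val A \<in> cvals A"
  by (auto simp: zero_val_def cvals_def)

lemma delay_cvals: "w \<in> cvals A \<Longrightarrow> 0 \<le> d \<Longrightarrow> delay A w d \<in> cvals A"
  by (auto simp: delay_def cvals_def intro!: add_nonneg_nonneg dest: PiE_mem)

lemma reset_cvals: "w \<in> cvals A \<Longrightarrow> reset_val A R w \<in> cvals A"
  by (auto simp: reset_val_def cvals_def)

lemma run_cvals:
  assumes "is_run A v N s d e" "enat n \<le> N"
  shows "snd (s n) \<in> cvals A"
  using assms(2)
proof (induction n)
  case 0
  then show ?case using assms by (simp add: is_run_def zero_val_cvals)
next
  case (Suc n)
  then have n: "enat n < N" by (simp add: Suc_ile_eq)
  then have "step A v (s n) (d n) (e n) (s (Suc n))" using assms(1) by (simp add: is_run_def)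
  then show ?case using Suc.IH n by (auto simp: step_iff intro!: reset_cvals delay_cvals)
qed

text \<open>Zones contain states after time has elapsed, hence the arbitrary delay
  \<open>d'\<close>: the induction step needs it for the delay with which location \<open>n\<close>
  is left.\<close>

lemma run_in_zone_at:
  assumes "is_run A v N s d e" "enat n \<le> N" "v \<in> pvals A" "0 \<le> d'"
    and "sat (delay A (snd (s n)) d') v (invar A (loc_at A e n))"
  shows "(delay A (snd (s n)) d', v) \<in> zone_at A e n"
  using assms(2,4,5)
proof (induction n arbitrary: d')
  case 0
  have "snd (s 0) = zero_val A" using assms(1) by (simp add: is_run_def)
  then show ?case
    using 0 assms(3) by (auto simp: sym_init_def elapse_def zone_of_def intro!: delay_cvals zero_val_cvals)
next
  case (Suc n)
  then have n: "enat n < N" by (simp add: Suc_ile_eq)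
  then have st: "step A v (s n) (d n) (e n) (s (Suc n))" using assms(1) by (simp add: is_run_def)
  have "src (e n) = loc_at A e n"
    using st run_loc[OF assms(1) less_imp_le[OF n]] by (simp add: step_iff)
  then have "(delay A (snd (s n)) (d n), v) \<in> zone_at A e n"
    using Suc.IH[of "d n"] n st by (simp add: step_iff)
  moreover have "(delay A (snd (s n)) (d n), v) \<in> zone_of A (guard (e n))"
    using st assms(3) run_cvals[OF assms(1) less_imp_le[OF n]]
    by (auto simp: zone_of_def step_iff intro!: delay_cvals)
  ultimately have "(snd (s (Suc n)), v) \<in> reset A (resets (e n)) (zone_at A e n \<inter> zone_of A (guard (e n)))"
    using st by (auto simp: reset_def step_iff)
  moreover have "(delay A (snd (s (Suc n))) d', v) \<in> zone_of A (invar A (tgt (e n)))"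
    using Suc.prems assms(3) run_cvals[OF assms(1) Suc.prems(1)]
    by (auto simp: zone_of_def intro!: delay_cvals)
  ultimately show ?case using Suc.prems by (auto simp: elapse_def)
qed

lemma run_proj_zone_at:
  assumes "is_run A v (enat n) s d e" "v \<in> pvals A"
  shows "v \<in> proj (zone_at A e n)"
proof -
  \<comment> \<open>No edge leaves the last state of the run, so admissibility has to supply the
    delay.\<close>
  have "admissible A v (s n)"
    using assms(1) by (cases n) (auto simp: is_run_def step_iff)
  then obtain d' where "0 \<le> d'" "sat (delay A (snd (s n)) d') v (invar A (loc_at A e n))"
    using run_loc[OF assms(1), of n] by (cases "s n") (auto simp: admissible_def)
  then show ?thesis using run_in_zone_at[OF assms(1) _ assms(2)] by (auto simp: proj_def)
qed

text \<open>The run is read off backwards from a zone element: each zone element is a delayed entry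
  state, and that delay becomes the delay of the next step.\<close>

lemma zone_at_run:
  assumes "is_path A n e" "(u, v) \<in> zone_at A e n"
  shows "\<exists>s d d'. is_run A v (enat n) s d e \<and> 0 \<le> d' \<and> u = delay A (snd (s n)) d'"
  using assms
proof (induction n arbitrary: u)
  case 0
  then obtain d' where d': "0 \<le> d'" "u = delay A (zero_val A) d'" "sat u v (invar A (loc0 A))"
    by (auto simp: sym_init_def elapse_def zone_of_def)
  then have "is_run A v (enat 0) (\<lambda>i. (loc0 A, zero_val A)) (\<lambda>i. 0) e"
    by (auto simp: is_run_def admissible_def zero_enat_def[symmetric])
  then show ?case using d' by fastforce
next
  case (Suc n)
  from Suc.prems(2) obtain w d' where w: "(w, v) \<in> zone_at A e n" "sat w v (guard (e n))"
    "u = delay A (reset_val A (resets (e n)) w) d'" "0 \<le> d'" "sat u v (invar A (tgt (e n)))"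
    by (auto simp: elapse_def reset_def zone_of_def)
  have p: "is_path A n e" "e n \<in> edges A" "src (e n) = loc_at A e n"
    using Suc.prems(1) by (auto simp: is_path_Suc)
  obtain s d d'' where r: "is_run A v (enat n) s d e" "0 \<le> d''" "w = delay A (snd (s n)) d''"
    using Suc.IH[OF p(1) w(1)] by blast
  define s' where "s' = s(Suc n := (tgt (e n), reset_val A (resets (e n)) w))"
  \<comment> \<open>The delay \<open>d'\<close> leading to \<open>u\<close> is the witness.\<close>
  have "admissible A v (s' (Suc n))" using w by (auto simp: s'_def admissible_def)
  moreover have "fst (s n) = src (e n)" using run_loc[OF r(1)] p by simp
  moreover have "sat w v (invar A (src (e n)))" using zone_at_imp_invar[OF w(1)] p by simp
  ultimately have "step A v (s n) d'' (e n) (s' (Suc n))"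
    using p w r by (simp add: step_iff s'_def)
  then have "is_run A v (enat (Suc n)) s' (d(n := d'')) e"
    using r(1) by (auto simp: is_run_def s'_def less_Suc_eq)
  moreover have "u = delay A (snd (s' (Suc n))) d'" using w by (simp add: s'_def)
  ultimately show ?case using w(4) by blast
qed

section \<open>The explored symbolic states\<close>

lemma mem_upd_good: "v \<in> K \<Longrightarrow> v \<in> upd_good v S K"
  by (auto simp: upd_good_def good_def compatible_def)

lemma not_mem_upd_bad: "v \<notin> K \<Longrightarrow> v \<notin> upd_bad v S K"
  by (auto simp: upd_bad_def bad_def compatible_def)

text \<open>\<open>Kgood\<close> is only intersected with projections that contain \<open>v\<close>,
  and \<open>Kbad\<close> only grows by projections that omit \<open>v\<close>.\<close>

lemma TPS_loop_contains:
  assumes "TPS_loop A v Kgood Kbad Snew S K" "v \<in> Kgood" "v \<notin> Kbad"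
  shows "v \<in> K"
  using assms by induction (simp_all add: mem_upd_good not_mem_upd_bad)

text \<open>\<open>G\<close> is the final value of \<open>S\<close>. Successors of states already in
  \<open>S\<close> belong to earlier iterations, hence \<open>G - S\<close>; at the initial call
  \<open>S\<close> is empty and the dichotomy covers all of \<open>Succ A G\<close>.\<close>

lemma TPS_loop_explored:
  assumes "TPS_loop A v Kgood Kbad Snew S K"
  shows "\<exists>G. S \<subseteq> G \<and> K \<subseteq> Kgood \<and> K \<inter> Kbad = {} \<and>
    (\<forall>s \<in> Snew \<union> Succ A (G - S). s \<in> G \<and> K \<subseteq> proj (snd s) \<or> K \<inter> proj (snd s) = {})"
  using assms
proof induction
  case (return Snew S Kgood Kbad)
  then show ?case
    by (intro exI[of _ S]) (fastforce simp: upd_good_def upd_bad_def good_def bad_def Succ_def)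
next
  case (iterate Snew S Kgood Kbad K)
  then obtain G where G: "S \<union> good v Snew \<subseteq> G" "K \<subseteq> upd_good v Snew Kgood"
    "K \<inter> upd_bad v Snew Kbad = {}"
    "\<forall>s \<in> Succ A (good v Snew) \<union> Succ A (G - (S \<union> good v Snew)).
       s \<in> G \<and> K \<subseteq> proj (snd s) \<or> K \<inter> proj (snd s) = {}"
    by blast
  have K: "K \<subseteq> Kgood" "K \<inter> Kbad = {}"
    using G(2,3) by (auto simp: upd_good_def upd_bad_def)
  have "s \<in> G \<and> K \<subseteq> proj (snd s) \<or> K \<inter> proj (snd s) = {}" if s: "s \<in> Snew" for s
  proof (cases "s \<in> good v Snew")
    case True
    then have "upd_good v Snew Kgood \<subseteq> proj (snd s)"
      by (cases s) (auto simp: upd_good_def)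
    then show ?thesis using G(1,2) True by blast
  next
    case False
    then have "s \<in> bad v Snew" using s by (simp add: good_def bad_def)
    then have "proj (snd s) \<subseteq> upd_bad v Snew Kbad"
      by (cases s) (auto simp: upd_bad_def)
    then show ?thesis using G(3) by blast
  qed
  \<comment> \<open>The successors of \<open>good v Snew\<close> are the next \<open>Snew\<close>,
    so the induction hypothesis covers both parts.\<close>
  moreover have "Succ A (G - S) \<subseteq> Succ A (good v Snew) \<union> Succ A (G - (S \<union> good v Snew))"
    unfolding Succ_def by blast
  ultimately have "\<forall>s \<in> Snew \<union> Succ A (G - S). s \<in> G \<and> K \<subseteq> proj (snd s) \<or> K \<inter> proj (snd s) = {}"
    using G(4) by blast
  then show ?case using G(1) K by blast
qed

text \<open>Along the run \<open>v1\<close> lies in every projection, which excludes disjointness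
  from \<open>K\<close>. So each symbolic state on the path is in \<open>G\<close> and its
  projection contains all of \<open>K\<close>, in particular \<open>v2\<close>.\<close>

lemma finite_run_transfer:
  assumes K: "TPS A v K" "v1 \<in> K" "v2 \<in> K" "v1 \<in> pvals A"
    and run: "is_run A v1 (enat n) s d e"
  shows "\<exists>s' d'. is_run A v2 (enat n) s' d' e"
proof -
  obtain G where G: "\<And>s. s \<in> insert (sym_init A) (Succ A G) \<Longrightarrow>
      s \<in> G \<and> K \<subseteq> proj (snd s) \<or> K \<inter> proj (snd s) = {}"
  proof -
    from TPS_loop_explored[OF K(1)[unfolded TPS_def]] obtain G where
      G: "\<forall>s \<in> {sym_init A} \<union> Succ A (G - {}). s \<in> G \<and> K \<subseteq> proj (snd s) \<or> K \<inter> proj (snd s) = {}"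
      by blast
    show ?thesis
    proof (rule that[of G])
      show "s \<in> G \<and> K \<subseteq> proj (snd s) \<or> K \<inter> proj (snd s) = {}"
        if "s \<in> insert (sym_init A) (Succ A G)" for s
        using bspec[OF G, of s] that by simp
    qed
  qed
  have path: "is_path A n e" using run_is_path[OF run] by simp
  have "(loc_at A e n, zone_at A e n) \<in> G \<and> K \<subseteq> proj (zone_at A e n)"
    using path run_proj_zone_at[OF run K(4)]
  proof (induction n)
    case 0
    have "(loc_at A e 0, zone_at A e 0) = sym_init A" by (simp add: sym_init_def)
    then show ?case using G[of "sym_init A"] 0 K(2) by auto
  next
    case (Suc n)
    let ?s = "(loc_at A e (Suc n), zone_at A e (Suc n))"
    have "(loc_at A e n, zone_at A e n) \<in> G"
      using Suc proj_zone_at_Suc[OF Suc.prems(2)] by (simp add: is_path_Suc)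
    moreover have "?s \<in> Succ_edge A (e n) (loc_at A e n, zone_at A e n)"
      using Suc.prems by (auto simp: Succ_edge_eq is_path_Suc Let_def proj_def)
    ultimately have "?s \<in> Succ A G"
      using Suc.prems(1) unfolding Succ_def is_path_Suc by blast
    then show ?case using G[of ?s] Suc.prems(2) K(2) by auto
  qed
  then obtain u where "(u, v2) \<in> zone_at A e n" using K(3) by (auto simp: proj_def)
  then show ?thesis using zone_at_run[OF path] by blast
qed

section \<open>Infinite runs\<close>

text \<open>Entering the run counts as a reset at index \<open>0\<close>; otherwise index \<open>n + 1\<close> stands for
  the time at which edge \<open>e n\<close> is taken.\<close>

fun last_reset :: "(nat \<Rightarrow> ('a, 'l, 'x, 'p) edge) \<Rightarrow> 'x \<Rightarrow> nat \<Rightarrow> nat" where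
  "last_reset e x 0 = 0"
| "last_reset e x (Suc n) = (if x \<in> resets (e n) then Suc n else last_reset e x n)"

lemma last_reset_le: "last_reset e x n \<le> n"
  by (induction n) (auto simp: le_Suc_eq)

text \<open>Clock values are written as differences of timestamps, which turns guards and invariants
  into difference constraints.\<close>

definition entry_val :: "('a, 'l, 'x, 'p) pta \<Rightarrow> (nat \<Rightarrow> ('a, 'l, 'x, 'p) edge) \<Rightarrow>
    (nat \<Rightarrow> real) \<Rightarrow> nat \<Rightarrow> 'x cval" where
  "entry_val A e t n = (\<lambda>x \<in> clocks A. t n - t (last_reset e x n))"

definition exit_val :: "('a, 'l, 'x, 'p) pta \<Rightarrow> (nat \<Rightarrow> ('a, 'l, 'x, 'p) edge) \<Rightarrow>
    (nat \<Rightarrow> real) \<Rightarrow> nat \<Rightarrow> 'x cval" where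
  "exit_val A e t n = (\<lambda>x \<in> clocks A. t (Suc n) - t (last_reset e x n))"

lemma entry_val_0: "entry_val A e t 0 = zero_val A"
  by (auto simp: entry_val_def zero_val_def)

lemma delay_entry_val: "delay A (entry_val A e t n) (t (Suc n) - t n) = exit_val A e t n"
  by (auto simp: entry_val_def exit_val_def delay_def fun_eq_iff)

lemma reset_exit_val: "reset_val A (resets (e n)) (exit_val A e t n) = entry_val A e t (Suc n)"
  by (auto simp: entry_val_def exit_val_def reset_val_def fun_eq_iff)

lemma run_timestamps:
  assumes "is_run A v (enat n) s d e"
  obtains t where "mono t"
    "\<And>i. i < n \<Longrightarrow> sat (exit_val A e t i) v (invar A (src (e i))) \<and> sat (exit_val A e t i) v (guard (e i))"
proof -
  \<comment> \<open>Setting the delays from index \<open>n\<close> on to 0 makes \<open>t\<close>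
    monotone on all naturals, as \<open>difference_compactness\<close> demands.\<close>
  define t where "t i = (\<Sum>k<i. if k < n then d k else 0)" for i
  have st: "step A v (s i) (d i) (e i) (s (Suc i))" if "i < n" for i
    using assms that by (simp add: is_run_def)
  then have d: "0 \<le> d i" if "i < n" for i using that by (simp add: step_iff)
  have t_diff: "d i = t (Suc i) - t i" if "i < n" for i using that by (simp add: t_def)
  have s: "snd (s i) = entry_val A e t i" if "i \<le> n" for i
    using that
  proof (induction i)
    case 0
    then show ?case using assms by (simp add: is_run_def entry_val_0)
  next
    case (Suc i)
    then show ?case
      using st[of i] by (simp add: step_iff t_diff delay_entry_val reset_exit_val)
  qed
  show ?thesis
  proof (rule that[of t])
    show "mono t" using d by (auto simp: mono_iff_le_Suc t_def)
    show "sat (exit_val A e t i) v (invar A (src (e i))) \<and> sat (exit_val A e t i) v (guard (e i))"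
      if "i < n" for i
      using st[OF that] that by (simp add: step_iff t_diff delay_entry_val s)
  qed
qed

text \<open>Every location on an infinite path is left, and the invariant at that moment witnesses
  admissibility on entry.\<close>

lemma timestamps_run:
  assumes "\<And>n. is_path A n e" "mono t"
    and sat: "\<And>i. sat (exit_val A e t i) v (invar A (src (e i))) \<and> sat (exit_val A e t i) v (guard (e i))"
  shows "is_run A v \<infinity> (\<lambda>i. (src (e i), entry_val A e t i)) (\<lambda>i. t (Suc i) - t i) e"
proof -
  have e: "e i \<in> edges A" "src (e i) = loc_at A e i" for i
    using assms(1)[of "Suc i"] by (simp_all add: is_path_Suc)
  have t: "0 \<le> t (Suc i) - t i" for i using assms(2) by (simp add: mono_iff_le_Suc)
  have adm: "admissible A v (src (e i), entry_val A e t i)" for i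
    using sat[of i] t[of i] by (auto simp: admissible_def delay_entry_val intro!: exI[of _ "t (Suc i) - t i"])
  have src: "src (e 0) = loc0 A" "src (e (Suc i)) = tgt (e i)" for i
    using e(2)[of 0] e(2)[of "Suc i"] by simp_all
  have "admissible A v (loc0 A, zero_val A)" "admissible A v (tgt (e i), entry_val A e t (Suc i))" for i
    using adm[of 0] adm[of "Suc i"] by (simp_all add: src entry_val_0)
  then show ?thesis
    using src e(1) t sat by (simp add: is_run_def step_iff delay_entry_val reset_exit_val entry_val_0)
qed

section \<open>Passing constraints to the limit\<close>

fun atom_const :: "'p pval \<Rightarrow> ('x, 'p) atom \<Rightarrow> rat" where
  "atom_const v (ClockParam x r p c) = v p + c"
| "atom_const v (ClockConst x r c) = c"
| "atom_const v (ParamConst p r c) = c"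

text \<open>All five comparisons are Boolean combinations of \<open><\<close> and \<open>=\<close>,
  which is why the compactness lemmas track just these two.\<close>

lemma compare_cong:
  assumes "s < q \<longleftrightarrow> s' < q" "s = q \<longleftrightarrow> s' = q"
  shows "compare r s q \<longleftrightarrow> compare r s' q"
  using assms by (cases r) auto

lemma sat_cong:
  assumes "constr_over X P C"
    and "\<And>x a. x \<in> X \<Longrightarrow> a \<in> set C \<Longrightarrow>
      (w x < of_rat (atom_const v a) \<longleftrightarrow> w' x < of_rat (atom_const v a)) \<and>
      (w x = of_rat (atom_const v a) \<longleftrightarrow> w' x = of_rat (atom_const v a))"
  shows "sat w v C \<longleftrightarrow> sat w' v C"
proof -
  have "atom_sat w v a \<longleftrightarrow> atom_sat w' v a" if a: "a \<in> set C" for a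
  proof -
    have "atom_over X P a" using assms(1) a by (auto simp: constr_over_def)
    then show ?thesis
      using assms(2)[OF _ a] by (cases a) (auto intro!: compare_cong)
  qed
  then show ?thesis by (simp add: sat_def)
qed

lemma infinite_run_of_finite_runs:
  assumes A: "is_pta A" and runs: "\<And>n. \<exists>s d. is_run A v (enat n) s d e"
  shows "\<exists>s d. is_run A v \<infinity> s d e"
proof -
  have path: "is_path A n e" for n using runs[of n] run_is_path by blast
  have e: "e i \<in> edges A" for i using path[of "Suc i"] by (simp add: is_path_Suc)
  have "\<exists>t. mono t \<and> (\<forall>i < n. sat (exit_val A e t i) v (invar A (src (e i))) \<and>
      sat (exit_val A e t i) v (guard (e i)))" for n
    using runs[of n] run_timestamps by metis
  then obtain T where T: "\<And>n. mono (T n)"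
    "\<And>n i. i < n \<Longrightarrow> sat (exit_val A e (T n) i) v (invar A (src (e i))) \<and>
      sat (exit_val A e (T n) i) v (guard (e i))"
    by metis
  \<comment> \<open>All right-hand sides that can occur along \<open>e\<close>. They are rational
    because parameter values are, and finitely many because there are finitely many edges.\<close>
  define Q :: "real set" where
    "Q = (\<Union>f \<in> edges A. (\<lambda>a. of_rat (atom_const v a)) ` (set (invar A (src f)) \<union> set (guard f)))"
  have "finite Q" using A by (auto simp: Q_def is_pta_def)
  moreover have "Q \<subseteq> \<rat>" by (auto simp: Q_def)
  ultimately have "\<exists>t :: nat \<Rightarrow> real. mono t \<and> (\<forall>m. \<exists>n \<ge> m. \<forall>i \<le> m. \<forall>j \<le> i. \<forall>q \<in> Q.
      (t i - t j < q \<longleftrightarrow> T n i - T n j < q) \<and> (t i - t j = q \<longleftrightarrow> T n i - T n j = q))"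
    by (rule difference_compactness[OF T(1)])
  then obtain t :: "nat \<Rightarrow> real" where t: "mono t"
    "\<And>m. \<exists>n \<ge> m. \<forall>i \<le> m. \<forall>j \<le> i. \<forall>q \<in> Q.
      (t i - t j < q \<longleftrightarrow> T n i - T n j < q) \<and> (t i - t j = q \<longleftrightarrow> T n i - T n j = q)"
    by (elim exE conjE) (rule that, assumption, erule spec)
  have "sat (exit_val A e t i) v (invar A (src (e i))) \<and> sat (exit_val A e t i) v (guard (e i))" for i
  proof -
    \<comment> \<open>\<open>exit_val\<close> at \<open>i\<close> involves timestamps up to
      \<open>Suc i\<close>. The same bound gives \<open>i < n\<close>, so \<open>T n\<close>
      satisfies the constraints of step \<open>i\<close>.\<close>
    obtain n where n: "n \<ge> Suc i" "\<forall>k \<le> Suc i. \<forall>j \<le> k. \<forall>q \<in> Q.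
      (t k - t j < q \<longleftrightarrow> T n k - T n j < q) \<and> (t k - t j = q \<longleftrightarrow> T n k - T n j = q)"
      using t(2)[of "Suc i"] by blast
    have cong: "sat (exit_val A e t i) v C \<longleftrightarrow> sat (exit_val A e (T n) i) v C"
      if C: "constr_over (clocks A) (params A) C" "set C \<subseteq> set (invar A (src (e i))) \<union> set (guard (e i))" for C
    proof (rule sat_cong[OF C(1)])
      fix x a assume x: "x \<in> clocks A" and "a \<in> set C"
      then have "of_rat (atom_const v a) \<in> Q" using C(2) e[of i] by (fastforce simp: Q_def)
      moreover have "last_reset e x i \<le> Suc i" by (rule le_SucI[OF last_reset_le])
      ultimately show "(exit_val A e t i x < of_rat (atom_const v a) \<longleftrightarrow>
            exit_val A e (T n) i x < of_rat (atom_const v a)) \<and>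
          (exit_val A e t i x = of_rat (atom_const v a) \<longleftrightarrow>
            exit_val A e (T n) i x = of_rat (atom_const v a))"
        using n(2) x by (simp add: exit_val_def)
    qed
    have "constr_over (clocks A) (params A) (invar A (src (e i)))"
      "constr_over (clocks A) (params A) (guard (e i))"
      using A e[of i] by (cases "e i"; force simp: is_pta_def src_def guard_def)+
    then show ?thesis using cong T(2)[of i n] n(1) by auto
  qed
  then show ?thesis using timestamps_run[OF path t(1)] by blast
qed

lemma Traces_subset:
  assumes "is_pta A" "TPS A v K" "v1 \<in> K" "v2 \<in> K" "v1 \<in> pvals A"
  shows "Traces A v1 \<subseteq> Traces A v2"
proof
  fix \<tau> assume "\<tau> \<in> Traces A v1"
  then obtain N s d e where run: "is_run A v1 N s d e" and \<tau>: "\<tau> = trace N s e"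
    by (auto simp: Traces_def)
  have fin: "\<exists>s' d'. is_run A v2 (enat n) s' d' e" if "enat n \<le> N" for n
    using finite_run_transfer[OF assms(2-5) run_prefix[OF run that]] .
  \<comment> \<open>For infinite \<open>N\<close>, the transferred prefixes are unrelated runs
    sharing only the edges \<open>e\<close>; compactness joins them into one run.\<close>
  have "\<exists>s' d'. is_run A v2 N s' d' e"
  proof (cases N)
    case (enat n)
    then show ?thesis using fin by simp
  next
    case infinity
    then show ?thesis using infinite_run_of_finite_runs[OF assms(1)] fin by simp
  qed
  then obtain s' d' where run': "is_run A v2 N s' d' e" by blast
  then have "\<tau> = trace N s' e" using trace_run[OF run] trace_run[OF run'] \<tau> by simp
  then show "\<tau> \<in> Traces A v2" using run' by (auto simp: Traces_def)
qed

theorem theorem4p1: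
  fixes A :: "('a, 'l, 'x, 'p) pta" and v :: "'p pval" and K :: "'p pval set"
  assumes "is_pta A"
    and "v \<in> pvals A"
    and "TPS A v K"
  shows "v \<in> K \<and> (\<forall>v' \<in> pvals A. v' \<in> K \<longrightarrow> Traces A v' = Traces A v)"
proof -
  have "v \<in> K"
    using TPS_loop_contains[OF assms(3)[unfolded TPS_def]] assms(2) by simp
  then show ?thesis using Traces_subset[OF assms(1,3)] assms(2) by blast
qed

end
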